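(* Let $K$ be an algebraically closed field of characteristic $0$. Let $A$ be a $\mathbb{Z}_2$-graded $K$-algebra with a regular grading determined by the skew-symmetric bicharacter $\beta$, whose corresponding regular decomposition is minimal. Then the following statements hold: (1) $\beta(0,0)=\beta(0,1)=\beta(1,0)=1$ and $\beta(1,1)=-1$; (2) $\dim A=\infty$; (3) $T_{\mathbb{Z}_2}(A)=T_{\mathbb{Z}_2}(E)$, where $E$ is the infinite dimensional Grassmann algebra with its natural $\mathbb{Z}_2$-grading.
   Context: All algebras are associative unital algebras over $K$. A $\mathbb{Z}_2$-graded algebra $A=A_0\oplus A_1$ is regular with bicharacter $\beta\colon\mathbb{Z}_2\times\mathbb{Z}_2\to K^*$ if (i) for every $n\in\mathbb{N}$ and every $(g_1,\dots,g_n)\in\mathbb{Z}_2^n$ there exist $a_i\in A_{g_i}$ with $a_1\cdots a_n\neq0$; and (ii) $a_ga_h=\beta(g,h)a_ha_g$ for all $g,h\in\mathbb{Z}_2$, $a_g\in A_g$, $a_h\in A_h$. (Then $\beta$ is automatically a skew-symmetric bicharacter: $\beta(g,h)=\beta(h,g)^{-1}$ and $\beta$ is multiplicative in each argument.) Its regular decomposition is minimal if there are no $h\ne k$ in $\mathbb{Z}_2$ with $\beta(g,h)=\beta(g,k)$ for all $g\in\mathbb{Z}_2$. $T_{\mathbb{Z}_2}(R)$ is the ideal of $\mathbb{Z}_2$-graded polynomial identities of $R$: the set of polynomials in the free $\mathbb{Z}_2$-graded algebra (infinitely many noncommuting variables of each degree) that vanish when the variables are replaced by arbitrary homogeneous elements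 of $R$ of the corresponding degrees. $E$ is the unital algebra generated by $e_1,e_2,\dots$ with relations $e_ie_j=-e_je_i$ for all $i,j$; $E_0$ (resp. $E_1$) is the span of monomials of even length, including $1$ (resp. odd length). *)

theory Defs
  imports
    "HOL-Computational_Algebra.Polynomial"
    "HOL-Library.Poly_Mapping"
    "HOL-Library.Z2"
begin

section \<open>Graded algebras and regular gradings\<close>

text \<open>
  The group \<open>\<int>\<^sub>2\<close> is the additive group of the type \<^typ>\<open>bit\<close>.
  The class \<^class>\<open>ring_1\<close> excludes the zero algebra, which admits no regular grading.
\<close>

locale unital_algebra = vector_space scale
  for scale :: "'k::field \<Rightarrow> 'a::ring_1 \<Rightarrow> 'a" +
  assumes scale_mult_left: "scale c a * b = scale c (a * b)"
    and scale_mult_right: "a * scale c b = scale c (a * b)"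

locale Z2_graded_algebra = unital_algebra scale
  for scale :: "'k::field \<Rightarrow> 'a::ring_1 \<Rightarrow> 'a" +
  fixes A :: "bit \<Rightarrow> 'a set"
  assumes subspace_component: "subspace (A g)"
    and direct_sum: "\<exists>!p. p \<in> A 0 \<times> A 1 \<and> a = fst p + snd p"
    and mult_component: "a \<in> A g \<Longrightarrow> b \<in> A h \<Longrightarrow> a * b \<in> A (g + h)"

definition skew_symmetric_bicharacter :: "(bit \<Rightarrow> bit \<Rightarrow> 'k::field) \<Rightarrow> bool" where
  "skew_symmetric_bicharacter \<beta> \<longleftrightarrow>
     (\<forall>g h. \<beta> g h \<noteq> 0) \<and>
     (\<forall>g h. \<beta> g h = inverse (\<beta> h g)) \<and>
     (\<forall>g h k. \<beta> (g + h) k = \<beta> g k * \<beta> h k) \<and>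
     (\<forall>g h k. \<beta> g (h + k) = \<beta> g h * \<beta> g k)"

definition regular_grading ::
  "('k::field \<Rightarrow> 'a::ring_1 \<Rightarrow> 'a) \<Rightarrow> (bit \<Rightarrow> 'a set) \<Rightarrow> (bit \<Rightarrow> bit \<Rightarrow> 'k) \<Rightarrow> bool" where
  "regular_grading scale A \<beta> \<longleftrightarrow>
     (\<forall>g h. \<beta> g h \<noteq> 0) \<and>
     (\<forall>gs. \<exists>as. list_all2 (\<lambda>g a. a \<in> A g) gs as \<and> prod_list as \<noteq> 0) \<and>
     (\<forall>g h. \<forall>a\<in>A g. \<forall>b\<in>A h. a * b = scale (\<beta> g h) (b * a))"

definition minimal_decomposition :: "(bit \<Rightarrow> bit \<Rightarrow> 'k) \<Rightarrow> bool" where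
  "minimal_decomposition \<beta> \<longleftrightarrow> \<not> (\<exists>h k. h \<noteq> k \<and> (\<forall>g. \<beta> g h = \<beta> g k))"


section \<open>Free algebras and graded identities\<close>

datatype 'x free_monoid = Monomial (letters: "'x list")

instantiation free_monoid :: (type) monoid_add
begin

definition zero_free_monoid :: "'a free_monoid" where
  "0 = Monomial []"

definition plus_free_monoid :: "'a free_monoid \<Rightarrow> 'a free_monoid \<Rightarrow> 'a free_monoid" where
  "u + v = Monomial (letters u @ letters v)"

instance
  by standard (simp_all add: zero_free_monoid_def plus_free_monoid_def)

end

text \<open>
  The free monoid is written additively so that the multiplication of \<^theory>\<open>HOL-Library.Poly_Mapping\<close>
  is that of its monoid algebra, i.e. of the free associative unital algebra.
\<close>

type_synonym ('x, 'k) free_algebra = "'x free_monoid \<Rightarrow>\<^sub>0 'k"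

abbreviation var :: "'x \<Rightarrow> ('x, 'k::field) free_algebra" where
  "var x \<equiv> Poly_Mapping.single (Monomial [x]) 1"

definition evaluate ::
  "('k::field \<Rightarrow> 'a::ring_1 \<Rightarrow> 'a) \<Rightarrow> ('x \<Rightarrow> 'a) \<Rightarrow> ('x, 'k) free_algebra \<Rightarrow> 'a" where
  "evaluate scale \<phi> f =
     (\<Sum>w\<in>Poly_Mapping.keys f. scale (Poly_Mapping.lookup f w) (prod_list (map \<phi> (letters w))))"

text \<open>The pair \<open>(g, i)\<close> is the \<open>i\<close>-th variable of degree \<open>g\<close>.\<close>

definition graded_identities ::
  "('k::field \<Rightarrow> 'a::ring_1 \<Rightarrow> 'a) \<Rightarrow> (bit \<Rightarrow> 'a set) \<Rightarrow> (bit \<times> nat, 'k) free_algebra set" where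
  "graded_identities scale A =
     {f. \<forall>\<phi>. (\<forall>g i. \<phi> (g, i) \<in> A g) \<longrightarrow> evaluate scale \<phi> f = 0}"


section \<open>The Grassmann algebra\<close>

definition two_sided_ideal :: "'a::ring_1 set \<Rightarrow> bool" where
  "two_sided_ideal I \<longleftrightarrow>
     0 \<in> I \<and> (\<forall>x\<in>I. \<forall>y\<in>I. x + y \<in> I) \<and> (\<forall>x\<in>I. \<forall>a. a * x \<in> I \<and> x * a \<in> I)"

definition grassmann_ideal :: "(nat, 'k::field) free_algebra set" where
  "grassmann_ideal = two_sided_ideal hull {var i * var j + var j * var i | i j. True}"

lemma two_sided_ideal_grassmann: "two_sided_ideal grassmann_ideal"
  unfolding grassmann_ideal_def hull_def two_sided_ideal_def by auto

lemma grassmann_ideal_0: "0 \<in> grassmann_ideal"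
  and grassmann_ideal_add: "x \<in> grassmann_ideal \<Longrightarrow> y \<in> grassmann_ideal \<Longrightarrow> x + y \<in> grassmann_ideal"
  and grassmann_ideal_mult_left: "x \<in> grassmann_ideal \<Longrightarrow> a * x \<in> grassmann_ideal"
  and grassmann_ideal_mult_right: "x \<in> grassmann_ideal \<Longrightarrow> x * a \<in> grassmann_ideal"
  using two_sided_ideal_grassmann unfolding two_sided_ideal_def by blast+

lemma grassmann_ideal_uminus: "x \<in> grassmann_ideal \<Longrightarrow> - x \<in> grassmann_ideal"
  using grassmann_ideal_mult_left[of x "- 1"] by simp

lemma lookup_times_zero:
  fixes p q :: "('x, 'k::field) free_algebra"
  shows "Poly_Mapping.lookup (p * q) 0 = Poly_Mapping.lookup p 0 * Poly_Mapping.lookup q 0"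
proof -
  have sum_zero: "0 = k + l \<longleftrightarrow> k = 0 \<and> l = 0" for k l :: "'x free_monoid"
    by (cases k; cases l) (auto simp: zero_free_monoid_def plus_free_monoid_def)
  have "(\<Sum>l. Poly_Mapping.lookup q l when 0 = k + l) = (Poly_Mapping.lookup q 0 when k = 0)" for k
    by (cases "k = 0") (simp_all add: sum_zero)
  then show ?thesis
    by (simp add: lookup_mult mult_when)
qed

lemma one_notin_grassmann_ideal: "(1 :: (nat, 'k::field) free_algebra) \<notin> grassmann_ideal"
proof -
  let ?I = "{p :: (nat, 'k) free_algebra. Poly_Mapping.lookup p 0 = 0}"
  have lookup_var_zero: "Poly_Mapping.lookup (var i :: (nat, 'k) free_algebra) 0 = 0" for i
    by (simp add: lookup_single zero_free_monoid_def)
  have "two_sided_ideal ?I"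
    by (auto simp: two_sided_ideal_def lookup_times_zero lookup_add)
  moreover have "{var i * var j + var j * var i | i j. True} \<subseteq> ?I"
    using lookup_var_zero by (auto simp: lookup_times_zero lookup_add)
  ultimately have "grassmann_ideal \<subseteq> ?I"
    unfolding grassmann_ideal_def by (intro hull_minimal)
  then show ?thesis
    by (auto simp: lookup_one)
qed

definition grassmann_cong :: "(nat, 'k::field) free_algebra \<Rightarrow> (nat, 'k) free_algebra \<Rightarrow> bool" where
  "grassmann_cong p q \<longleftrightarrow> p - q \<in> grassmann_ideal"

lemma grassmann_cong_equivp: "equivp grassmann_cong"
proof (rule equivpI)
  show "reflp grassmann_cong"
    by (simp add: reflp_def grassmann_cong_def grassmann_ideal_0)
  show "symp grassmann_cong"
    unfolding symp_def grassmann_cong_def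
    using grassmann_ideal_uminus by fastforce
  show "transp grassmann_cong"
    unfolding transp_def grassmann_cong_def
    using grassmann_ideal_add by fastforce
qed

quotient_type (overloaded) 'k grassmann = "(nat, 'k::field) free_algebra" / grassmann_cong
  by (rule grassmann_cong_equivp)

instantiation grassmann :: (field) ring_1
begin

lift_definition zero_grassmann :: "'a grassmann" is 0 .

lift_definition one_grassmann :: "'a grassmann" is 1 .

lift_definition plus_grassmann :: "'a grassmann \<Rightarrow> 'a grassmann \<Rightarrow> 'a grassmann" is "(+)"
  unfolding grassmann_cong_def using grassmann_ideal_add by (force simp: algebra_simps)

lift_definition minus_grassmann :: "'a grassmann \<Rightarrow> 'a grassmann \<Rightarrow> 'a grassmann" is "(-)"
proof -
  fix a b c d :: "(nat, 'a) free_algebra"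
  assume "grassmann_cong a b" "grassmann_cong c d"
  then have "(a - b) + - (c - d) \<in> grassmann_ideal"
    unfolding grassmann_cong_def by (intro grassmann_ideal_add grassmann_ideal_uminus)
  then show "grassmann_cong (a - c) (b - d)"
    unfolding grassmann_cong_def by (simp add: algebra_simps)
qed

lift_definition uminus_grassmann :: "'a grassmann \<Rightarrow> 'a grassmann" is uminus
proof -
  fix a b :: "(nat, 'a) free_algebra"
  assume "grassmann_cong a b"
  then have "- (a - b) \<in> grassmann_ideal"
    unfolding grassmann_cong_def by (rule grassmann_ideal_uminus)
  then show "grassmann_cong (- a) (- b)"
    unfolding grassmann_cong_def by (simp add: algebra_simps)
qed

lift_definition times_grassmann :: "'a grassmann \<Rightarrow> 'a grassmann \<Rightarrow> 'a grassmann" is "(*)"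
proof -
  fix a b c d :: "(nat, 'a) free_algebra"
  assume "grassmann_cong a b" "grassmann_cong c d"
  then have "(a - b) * c + b * (c - d) \<in> grassmann_ideal"
    unfolding grassmann_cong_def
    by (intro grassmann_ideal_add grassmann_ideal_mult_left grassmann_ideal_mult_right)
  then show "grassmann_cong (a * c) (b * d)"
    unfolding grassmann_cong_def by (simp add: algebra_simps)
qed

instance
proof
  show "(0 :: 'a grassmann) \<noteq> 1"
    by transfer
      (use grassmann_ideal_uminus one_notin_grassmann_ideal in \<open>fastforce simp: grassmann_cong_def\<close>)
qed (transfer, simp add: grassmann_cong_def grassmann_ideal_0 algebra_simps)+

end

lift_definition grassmann_scale :: "'k::field \<Rightarrow> 'k grassmann \<Rightarrow> 'k grassmann"
  is "\<lambda>c p. Poly_Mapping.single 0 c * p"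
  unfolding grassmann_cong_def
  by (metis grassmann_ideal_mult_left right_diff_distrib)

lemma single_zero_commute:
  fixes p :: "('x, 'k::field) free_algebra"
  shows "p * Poly_Mapping.single 0 c = Poly_Mapping.single 0 c * p"
proof (induction p rule: update_induct)
  case const
  then show ?case by simp
next
  case (update f a b)
  have "Poly_Mapping.update a b f = f + Poly_Mapping.single a b"
    using update.hyps
    by (intro poly_mapping_eqI)
      (auto simp: lookup_update lookup_add lookup_single in_keys_iff when_def)
  with update show ?case
    by (simp add: distrib_left distrib_right mult_single mult.commute[of b c])
qed

interpretation grassmann: unital_algebra "grassmann_scale :: 'k::field \<Rightarrow> _"
proof
  fix a b :: 'k and x y :: "'k grassmann"
  show "grassmann_scale a (x + y) = grassmann_scale a x + grassmann_scale a y"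
    by transfer (simp add: grassmann_cong_def grassmann_ideal_0 algebra_simps)
  show "grassmann_scale (a + b) x = grassmann_scale a x + grassmann_scale b x"
    by transfer (simp add: grassmann_cong_def grassmann_ideal_0 single_add algebra_simps)
  show "grassmann_scale a (grassmann_scale b x) = grassmann_scale (a * b) x"
    by transfer (simp add: grassmann_cong_def grassmann_ideal_0 mult_single flip: mult.assoc)
  show "grassmann_scale 1 x = x"
    by transfer (simp add: grassmann_cong_def grassmann_ideal_0)
  show "grassmann_scale a x * y = grassmann_scale a (x * y)"
    by transfer (simp add: grassmann_cong_def grassmann_ideal_0 mult.assoc)
  show "x * grassmann_scale a y = grassmann_scale a (x * y)"
    by transfer
      (simp add: grassmann_cong_def grassmann_ideal_0 single_zero_commute flip: mult.assoc)
qed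

lift_definition grassmann_gen :: "nat \<Rightarrow> 'k::field grassmann" is var .

definition grassmann_component :: "bit \<Rightarrow> 'k::field grassmann set" where
  "grassmann_component g =
     module.span grassmann_scale
       {prod_list (map grassmann_gen is) | is. of_nat (length is) = g}"

end

theory Submission
  imports Defs "HOL-Library.Multiset"
begin

text \<open>
  In an algebra whose even elements are central on homogeneous elements and whose odd elements
  anticommute, a word in homogeneous elements is, up to a sign not depending on the algebra, the
  product of its sorted even letters and its sorted odd letters; the sign is replaced by \<open>0\<close> if an
  odd letter is repeated. Hence a polynomial is a graded identity as soon as, for every multidegree,
  the signed sum of its coefficients vanishes. Conversely, substitute \<open>t x\<close> for the even variables
  and \<open>t x\<close> times members of a long nonvanishing product of odd elements for the odd ones: distinct
  multidegrees are distinct characters in \<open>t\<close>, so by Dedekind's independence of characters every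
  multihomogeneous part vanishes, and its value is the signed sum times a nonzero element. Thus the
  graded identities depend only on the sign rule, which \<open>A\<close> and the Grassmann algebra share.
\<close>

section \<open>Signs of words\<close>

text \<open>The sign of the permutation that sorts the list, extended by \<open>0\<close> to lists
  with a repeated entry: each entry contributes -1 for every smaller entry to its right. It is the
  sign with which a word of odd letters equals its sorted form.\<close>

fun inversion_sign :: "'x::linorder list \<Rightarrow> 'k::comm_ring_1" where
  "inversion_sign [] = 1"
| "inversion_sign (x # xs) =
     (if x \<in> set xs then 0 else (- 1) ^ length (filter (\<lambda>y. y < x) xs)) * inversion_sign xs"

lemma inversion_sign_not_distinct: "\<not> distinct xs \<Longrightarrow> inversion_sign xs = 0"
  by (induction xs) auto

lemma inversion_sign_distinct: "distinct xs \<Longrightarrow> (inversion_sign xs :: 'k::idom) \<noteq> 0"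
  by (induction xs) auto

text \<open>Exchanging neighbours creates or removes one inversion, namely that of the pair itself;
  for \<open>i = j\<close> both sides are 0.\<close>

lemma inversion_sign_swap:
  "(inversion_sign (us @ i # j # vs) :: 'k::comm_ring_1) = - inversion_sign (us @ j # i # vs)"
proof (induction us)
  case Nil
  show ?case
    by (cases i j rule: linorder_cases) (auto simp: algebra_simps)
next
  case (Cons u us)
  have "length (filter (\<lambda>y. y < u) (us @ i # j # vs)) = length (filter (\<lambda>y. y < u) (us @ j # i # vs))"
    by simp
  with Cons show ?case
    by auto
qed

definition indices :: "bit \<Rightarrow> (bit \<times> 'x) list \<Rightarrow> 'x list" where
  "indices g w = map snd (filter (\<lambda>x. fst x = g) w)"

lemma mset_indices: "mset (indices g w) = image_mset snd (filter_mset (\<lambda>x. fst x = g) (mset w))"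
  by (simp add: indices_def)

lemma mset_eq_indices: "mset w = mset w' \<Longrightarrow> mset (indices g w) = mset (indices g w')"
  by (simp add: mset_indices)

text \<open>So all words of one multidegree share the same sorted normal form and differ only by
  sign.\<close>

lemma sort_indices_cong:
  fixes w w' :: "(bit \<times> 'x::linorder) list"
  shows "mset w = mset w' \<Longrightarrow> sort (indices g w) = sort (indices g w')"
  by (metis mset_eq_indices properties_for_sort mset_sort sorted_sort)


section \<open>Independence of multidegrees\<close>

text \<open>Some variable \<open>x\<close> has different multiplicities; sending it to 2 and all
  others to 1 gives two different powers of 2, distinct in characteristic 0.\<close>

lemma multidegree_separation:
  assumes "M \<noteq> N"
  shows "\<exists>s :: 'x \<Rightarrow> 'k::field_char_0. prod_mset (image_mset s M) \<noteq> prod_mset (image_mset s N)"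
proof -
  obtain x where x: "count M x \<noteq> count N x"
    using assms by (auto simp: multiset_eq_iff)
  let ?s = "\<lambda>y. if y = x then (2 :: 'k) else 1"
  have pow: "prod_mset (image_mset ?s P) = 2 ^ count P x" for P
    by (induction P) auto
  have "(2 :: 'k) ^ m = 2 ^ n \<longleftrightarrow> m = n" for m n :: nat
  proof -
    have "(2 :: 'k) ^ m = 2 ^ n \<longleftrightarrow> (of_nat (2 ^ m) :: 'k) = of_nat (2 ^ n)"
      by simp
    also have "\<dots> \<longleftrightarrow> m = n"
      by (subst of_nat_eq_iff) simp
    finally show ?thesis .
  qed
  with x pow show ?thesis
    by (intro exI[of _ ?s]) simp
qed

text \<open>Dedekind's argument with vector coefficients: each \<open>M\<close> gives a
  multiplicative function of \<open>t\<close>, and a relation is shortened by comparing its values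
  at \<open>s * t\<close> and at \<open>t\<close>.\<close>

lemma (in vector_space) multidegrees_independent:
  fixes v :: "'x multiset \<Rightarrow> 'b"
  assumes char: "\<And>M N. M \<noteq> N \<Longrightarrow>
      \<exists>s :: 'x \<Rightarrow> 'a. prod_mset (image_mset s M) \<noteq> prod_mset (image_mset s N)"
    and "finite F"
    and "\<And>t. (\<Sum>M\<in>F. scale (prod_mset (image_mset t M)) (v M)) = 0"
  shows "\<forall>M\<in>F. v M = 0"
  using assms(2,3)
proof (induction F arbitrary: v rule: finite_induct)
  case (insert N F)
  define \<chi> where "\<chi> t M = prod_mset (image_mset t M)" for t :: "'x \<Rightarrow> 'a" and M
  have mult: "\<chi> (\<lambda>x. s x * t x) M = \<chi> s M * \<chi> t M" for s t M
    by (simp add: \<chi>_def prod_mset.distrib)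
  have sum0: "scale (\<chi> t N) (v N) + (\<Sum>M\<in>F. scale (\<chi> t M) (v M)) = 0" for t
    using insert.prems[of t] insert.hyps by (simp add: \<chi>_def)
  have F0: "v M = 0" if M: "M \<in> F" for M
  proof -
    have "M \<noteq> N"
      using M insert.hyps by blast
    then obtain s where s: "\<chi> s M \<noteq> \<chi> s N"
      using char unfolding \<chi>_def by blast
    \<comment> \<open>The relation at \<open>s * t\<close> minus \<open>\<chi> s N\<close> times the
      relation at \<open>t\<close>: the term of \<open>N\<close> cancels and the induction
      hypothesis applies to the rest.\<close>
    have "(\<Sum>M\<in>F. scale (\<chi> t M) (scale (\<chi> s M - \<chi> s N) (v M))) = 0" for t
    proof -
      have 1: "scale (\<chi> s N) (scale (\<chi> t N) (v N)) + (\<Sum>M\<in>F. scale (\<chi> s M) (scale (\<chi> t M) (v M))) = 0"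
        using sum0[of "\<lambda>x. s x * t x"] by (simp add: mult)
      have 2: "scale (\<chi> s N) (scale (\<chi> t N) (v N)) + (\<Sum>M\<in>F. scale (\<chi> s N) (scale (\<chi> t M) (v M))) = 0"
        using arg_cong[OF sum0[of t], of "scale (\<chi> s N)"]
        by (simp add: scale_right_distrib scale_sum_right)
      have "(\<Sum>M\<in>F. scale (\<chi> t M) (scale (\<chi> s M - \<chi> s N) (v M))) =
          (\<Sum>M\<in>F. scale (\<chi> s M) (scale (\<chi> t M) (v M))) - (\<Sum>M\<in>F. scale (\<chi> s N) (scale (\<chi> t M) (v M)))"
        by (simp add: sum_subtractf[symmetric] scale_left_diff_distrib scale_right_diff_distrib mult.commute)
      with add_left_imp_eq[OF trans[OF 1 2[symmetric]]] show ?thesis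
        by simp
    qed
    then have "\<forall>M\<in>F. scale (\<chi> s M - \<chi> s N) (v M) = 0"
      by (intro insert.IH) (simp add: \<chi>_def)
    with M s show ?thesis
      by auto
  qed
  have "v N = 0"
    using sum0[of "\<lambda>_. 1"] F0 by (simp add: \<chi>_def)
  with F0 show ?case
    by blast
qed simp


section \<open>Supercommutative algebras\<close>

text \<open>The sign rule in isolation, as the common setting for \<open>A\<close> and the Grassmann
  algebra.\<close>

locale supercommutative_algebra = unital_algebra scale
  for scale :: "'k::field_char_0 \<Rightarrow> 'a::ring_1 \<Rightarrow> 'a" +
  fixes A :: "bit \<Rightarrow> 'a set"
  assumes subspace_homogeneous: "subspace (A g)"
    and one_even: "1 \<in> A 0"
    and even_commute: "a \<in> A 0 \<Longrightarrow> b \<in> A g \<Longrightarrow> a * b = b * a"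
    and odd_anticommute: "a \<in> A 1 \<Longrightarrow> b \<in> A 1 \<Longrightarrow> a * b = - (b * a)"
begin

lemma odd_square: "a \<in> A 1 \<Longrightarrow> a * a = 0"
proof -
  assume "a \<in> A 1"
  then have "a * a + a * a = 0"
    using odd_anticommute[of a a] by (metis add.left_inverse)
  then have "scale 2 (a * a) = 0"
    by (metis one_add_one scale_left_distrib scale_one)
  then show ?thesis
    by simp
qed

lemma prod_even_commute:
  "b \<in> A g \<Longrightarrow> set as \<subseteq> A 0 \<Longrightarrow> b * prod_list as = prod_list as * b"
proof (induction as)
  case (Cons a as)
  then have "b * a = a * b"
    using even_commute[of a b g] by auto
  with Cons show ?case
    by (metis insert_subset list.simps(15) mult.assoc prod_list.Cons)
qed simp

lemma insort_even:
  assumes "\<And>i. \<phi> i \<in> A 0"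
  shows "\<phi> x * prod_list (map \<phi> xs) = prod_list (map \<phi> (insort x xs))"
proof (induction xs)
  case (Cons y ys)
  have "\<phi> x * \<phi> y = \<phi> y * \<phi> x"
    using even_commute assms by blast
  with Cons show ?case
    by simp (metis mult.assoc)
qed simp

text \<open>As \<open>xs\<close> is sorted, \<open>\<phi> x\<close> first passes the smaller
  letters, each at the cost of a sign; an equal letter then gives a square, which is 0.\<close>

lemma insort_odd:
  assumes "\<And>i. \<phi> i \<in> A 1" and "sorted xs"
  shows "\<phi> x * prod_list (map \<phi> xs) =
    scale (if x \<in> set xs then 0 else (- 1) ^ length (filter (\<lambda>y. y < x) xs))
      (prod_list (map \<phi> (insort x xs)))"
  using assms(2)
proof (induction xs)
  case (Cons y ys)
  consider "x < y" | "x = y" | "y < x"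
    by fastforce
  then show ?case
  proof cases
    case 1
    with Cons.prems have "x \<notin> set ys" "filter (\<lambda>y. y < x) ys = []"
      by (auto simp: filter_empty_conv)
    with 1 show ?thesis
      by auto
  next
    case 2
    have "\<phi> y * (\<phi> y * z) = 0" for z
      using odd_square[OF assms(1), of y] by (metis mult.assoc mult_zero_left)
    with 2 show ?thesis
      by simp
  next
    case 3
    have "\<phi> x * (\<phi> y * z) = - (\<phi> y * (\<phi> x * z))" for z
      using odd_anticommute[OF assms(1) assms(1), of x y]
      by (metis mult.assoc mult_minus_left)
    with 3 Cons show ?thesis
      by (auto simp: scale_mult_right not_le)
  qed
qed simp

text \<open>Induction on the word: a new even letter is inserted into the even block without sign; a
  new odd letter passes the even block freely and enters the odd block by \<open>insort_odd\<close>,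
  whose factor is that in the recursion of \<open>inversion_sign\<close>.\<close>

lemma prod_word:
  assumes "\<And>g i. \<phi> (g, i) \<in> A g"
  shows "prod_list (map \<phi> w) = scale (inversion_sign (indices 1 w))
    (prod_list (map (\<lambda>i. \<phi> (0, i)) (sort (indices 0 w))) *
     prod_list (map (\<lambda>i. \<phi> (1, i)) (sort (indices 1 w))))"
proof (induction w)
  case Nil
  then show ?case
    by (simp add: indices_def)
next
  case (Cons x w)
  define E where "E = prod_list (map (\<lambda>i. \<phi> (0, i)) (sort (indices 0 w)))"
  define D where "D = prod_list (map (\<lambda>i. \<phi> (1, i)) (sort (indices 1 w)))"
  obtain g i where x: "x = (g, i)"
    by fastforce
  show ?case
  proof (cases g)
    case zero
    then have "indices 0 (x # w) = i # indices 0 w" "indices 1 (x # w) = indices 1 w"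
      by (auto simp: indices_def x)
    moreover have "\<phi> x * E = prod_list (map (\<lambda>i. \<phi> (0, i)) (insort i (sort (indices 0 w))))"
      using insort_even[of "\<lambda>i. \<phi> (0, i)" i "sort (indices 0 w)"] assms
      by (simp add: E_def x zero)
    ultimately show ?thesis
      using Cons.IH by (simp add: scale_mult_right mult.assoc flip: E_def D_def)
        (simp flip: mult.assoc)
  next
    case one
    then have ind: "indices 0 (x # w) = indices 0 w" "indices 1 (x # w) = i # indices 1 w"
      by (auto simp: indices_def x)
    define s :: 'k where
      "s = (if i \<in> set (indices 1 w) then 0 else (- 1) ^ length (filter (\<lambda>y. y < i) (indices 1 w)))"
    \<comment> \<open>\<open>insort_odd\<close> counts smaller letters in the sorted list,
      \<open>inversion_sign\<close> in the original one; the multiset decides both.\<close>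
    have "length (filter (\<lambda>y. y < i) (sort (indices 1 w))) = length (filter (\<lambda>y. y < i) (indices 1 w))"
      by (metis mset_filter mset_sort size_mset)
    then have D: "\<phi> x * D = scale s (prod_list (map (\<lambda>i. \<phi> (1, i)) (insort i (sort (indices 1 w)))))"
      using insort_odd[of "\<lambda>i. \<phi> (1, i)" "sort (indices 1 w)" i] assms
      by (simp add: D_def x one s_def)
    have E: "\<phi> x * E = E * \<phi> x"
      unfolding E_def x using assms by (intro prod_even_commute) auto
    have "prod_list (map \<phi> (x # w)) = scale (inversion_sign (indices 1 w)) (\<phi> x * (E * D))"
      using Cons.IH by (simp add: scale_mult_right flip: E_def D_def)
    also have "\<phi> x * (E * D) = E * (\<phi> x * D)"
      using E by (metis mult.assoc)
    finally show ?thesis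
      by (simp add: ind D scale_mult_right mult.commute flip: E_def s_def)
  qed
qed

lemma prod_odd:
  assumes "\<And>i. \<phi> i \<in> A 1"
  shows "prod_list (map \<phi> xs) = scale (inversion_sign xs) (prod_list (map \<phi> (sort xs)))"
proof -
  \<comment> \<open>The word has no even letters; 1 is only an admissible value for the even
    variables.\<close>
  define \<psi> where "\<psi> = (\<lambda>(g :: bit, i). if g = 0 then 1 else \<phi> i)"
  have "\<psi> (g, i) \<in> A g" for g i
    using assms one_even by (cases g) (auto simp: \<psi>_def)
  moreover have "indices 1 (map (Pair 1) xs) = xs" "indices 0 (map (Pair 1) xs) = []"
    by (induction xs) (auto simp: indices_def)
  ultimately show ?thesis
    using prod_word[of \<psi> "map (Pair 1) xs"] by (simp add: \<psi>_def comp_def)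
qed

end

section \<open>Multihomogeneous parts and their signed sums\<close>

text \<open>The coefficient that the part of \<open>f\<close> of multidegree \<open>M\<close>
  receives once its words are brought to sorted form. It refers to no particular algebra.\<close>

definition signed_sum :: "(bit \<times> nat, 'k::field) free_algebra \<Rightarrow> (bit \<times> nat) multiset \<Rightarrow> 'k" where
  "signed_sum f M = (\<Sum>w \<in> {w \<in> Poly_Mapping.keys f. mset (letters w) = M}.
     Poly_Mapping.lookup f w * inversion_sign (indices 1 (letters w)))"

lemma (in unital_algebra) evaluate_multihomogeneous:
  "evaluate scale \<phi> f = (\<Sum>M \<in> (\<lambda>w. mset (letters w)) ` Poly_Mapping.keys f.
     \<Sum>w \<in> {w \<in> Poly_Mapping.keys f. mset (letters w) = M}.
       scale (Poly_Mapping.lookup f w) (prod_list (map \<phi> (letters w))))"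
  unfolding evaluate_def by (rule sum.group[symmetric]) auto

lemma (in unital_algebra) prod_list_scale:
  "prod_list (map (\<lambda>x. scale (t x) (\<phi> x)) xs) =
     scale (prod_mset (image_mset t (mset xs))) (prod_list (map \<phi> xs))"
  by (induction xs) (simp_all add: scale_mult_left scale_mult_right mult.commute)

text \<open>Here \<open>w\<close> is any word representing \<open>M\<close>; it serves to write down
  the normal form common to all words of that multidegree.\<close>

lemma (in supercommutative_algebra) evaluate_multihomogeneous_part:
  assumes "\<And>g i. \<phi> (g, i) \<in> A g" and "mset w = M"
  shows "(\<Sum>u \<in> {u \<in> Poly_Mapping.keys f. mset (letters u) = M}.
       scale (Poly_Mapping.lookup f u) (prod_list (map \<phi> (letters u)))) =
    scale (signed_sum f M)
      (prod_list (map (\<lambda>i. \<phi> (0, i)) (sort (indices 0 w))) *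
       prod_list (map (\<lambda>i. \<phi> (1, i)) (sort (indices 1 w))))"
proof -
  have "prod_list (map \<phi> (letters u)) = scale (inversion_sign (indices 1 (letters u)))
      (prod_list (map (\<lambda>i. \<phi> (0, i)) (sort (indices 0 w))) *
       prod_list (map (\<lambda>i. \<phi> (1, i)) (sort (indices 1 w))))"
    if "mset (letters u) = M" for u
    using prod_word[OF assms(1), of "letters u"] sort_indices_cong[of "letters u" w] assms(2) that
    by simp
  then show ?thesis
    by (simp add: signed_sum_def scale_sum_left)
qed

section \<open>Long nonvanishing odd products: dimension and identities\<close>

locale regular_supercommutative_algebra = supercommutative_algebra scale A
  for scale :: "'k::field_char_0 \<Rightarrow> 'a::ring_1 \<Rightarrow> 'a" and A :: "bit \<Rightarrow> 'a set" +
  assumes nonvanishing: "\<exists>as. length as = n \<and> set as \<subseteq> A 1 \<and> prod_list as \<noteq> 0"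
begin

text \<open>Append to \<open>xs\<close> the missing indices below \<open>n\<close>: the longer
  product is, up to sign, the given nonzero product of \<open>n\<close> odd elements, so its initial
  factor is nonzero.\<close>

lemma nonvanishing_family:
  obtains a :: "nat \<Rightarrow> 'a" where "\<And>i. a i \<in> A 1"
    and "\<And>xs. distinct xs \<Longrightarrow> set xs \<subseteq> {..<n} \<Longrightarrow> prod_list (map a xs) \<noteq> 0"
proof -
  obtain as where as: "length as = n" "set as \<subseteq> A 1" "prod_list as \<noteq> 0"
    using nonvanishing by blast
  \<comment> \<open>The value 0 from \<open>n\<close> on lies in \<open>A 1\<close>, so every
    \<open>a i\<close> is odd.\<close>
  define a where "a i = (if i < n then as ! i else 0)" for i
  have odd: "a i \<in> A 1" for i
    using as subspace_0[OF subspace_homogeneous] by (auto simp: a_def)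
  have map_a: "map a [0..<n] = as"
    using as(1) by (intro nth_equalityI) (auto simp: a_def)
  have "prod_list (map a xs) \<noteq> 0" if xs: "distinct xs" "set xs \<subseteq> {..<n}" for xs
  proof -
    define ys where "ys = filter (\<lambda>i. i \<notin> set xs) [0..<n]"
    have dist: "distinct (xs @ ys)" and set: "set (xs @ ys) = {..<n}"
      using xs by (auto simp: ys_def)
    have "sort (xs @ ys) = [0..<n]"
      using dist set by (intro sorted_distinct_set_unique) (auto simp: distinct_sort)
    then have "prod_list (map a (xs @ ys)) = scale (inversion_sign (xs @ ys)) (prod_list as)"
      using prod_odd[of a "xs @ ys"] odd map_a by simp
    also have "\<dots> \<noteq> 0"
      using inversion_sign_distinct[OF dist] as(3) by simp
    finally show ?thesis
      by auto
  qed
  with odd that show thesis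
    by blast
qed

text \<open>The factors of a nonvanishing odd product are independent: the product of all but one of
  them annihilates their span on the left, since a factor is repeated, but not the omitted
  factor.\<close>

lemma infinite_dimensional: "\<not> (\<exists>B. finite_dimensional_vector_space scale B)"
proof
  assume "\<exists>B. finite_dimensional_vector_space scale B"
  then obtain B where "finite_dimensional_vector_space scale B" ..
  then have B: "finite B" "span B = UNIV"
    using finite_dimensional_vector_space.finite_Basis finite_dimensional_vector_space.span_Basis
    by blast+
  \<comment> \<open>One more element than a finite spanning set allows to be independent.\<close>
  define n where "n = Suc (card B)"
  obtain a where odd: "\<And>i. a i \<in> A 1"
    and nz: "\<And>xs. distinct xs \<Longrightarrow> set xs \<subseteq> {..<n} \<Longrightarrow> prod_list (map a xs) \<noteq> 0"
    using nonvanishing_family[of n] by blast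
  have inj: "inj_on a {..<n}"
  proof (rule inj_onI, rule ccontr)
    fix i j assume "i \<in> {..<n}" "j \<in> {..<n}" "a i = a j" "i \<noteq> j"
    then show False
      using nz[of "[i, j]"] odd_square[OF odd, of j] by simp
  qed
  have "independent (a ` {..<n})"
  proof
    assume "dependent (a ` {..<n})"
    then obtain i where i: "i < n" and span: "a i \<in> span (a ` {..<n} - {a i})"
      by (auto simp: dependent_def)
    define xs where "xs = filter (\<lambda>j. j \<noteq> i) [0..<n]"
    define P where "P = prod_list (map a xs)"
    have "x * P = 0" if "x \<in> span (a ` {..<n} - {a i})" for x
      using that
    proof (induction rule: span_induct_alt)
      case (step c x y)
      then obtain j where "x = a j" "j \<in> set xs"
        by (auto simp: xs_def)
      then have "x * P = 0"
        using prod_odd[of a "j # xs"] odd by (simp add: P_def)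
      with step show ?case
        by (simp add: distrib_right scale_mult_left)
    qed simp
    with span have "prod_list (map a (i # xs)) = 0"
      by (simp add: P_def)
    with i nz[of "i # xs"] show False
      by (auto simp: xs_def)
  qed
  then have "card (a ` {..<n}) \<le> card B"
    using independent_span_bound[of B "a ` {..<n}"] B by auto
  with inj show False
    by (simp add: card_image n_def)
qed

text \<open>The criterion mentions neither \<open>scale\<close> nor \<open>A\<close>, so any two
  such algebras over the same field have the same graded identities.\<close>

theorem graded_identities_iff: "f \<in> graded_identities scale A \<longleftrightarrow> (\<forall>M. signed_sum f M = 0)"
proof
  assume zero: "\<forall>M. signed_sum f M = 0"
  have "evaluate scale \<phi> f = 0" if "\<And>g i. \<phi> (g, i) \<in> A g" for \<phi>
    unfolding evaluate_multihomogeneous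
  proof (rule sum.neutral, rule ballI, goal_cases)
    case (1 M)
    obtain w where "mset w = M"
      using ex_mset by blast
    with zero show ?case
      by (simp add: evaluate_multihomogeneous_part[OF that])
  qed
  then show "f \<in> graded_identities scale A"
    by (simp add: graded_identities_def)
next
  assume f: "f \<in> graded_identities scale A"
  define F where "F = (\<lambda>w. mset (letters w)) ` Poly_Mapping.keys f"
  have "finite (\<Union>w\<in>Poly_Mapping.keys f. set (indices 1 (letters w)))"
    by simp
  \<comment> \<open>A bound on all odd indices occurring in \<open>f\<close>, so that the family
    below is nonvanishing on each of its words with distinct odd letters.\<close>
  then obtain n where n: "(\<Union>w\<in>Poly_Mapping.keys f. set (indices 1 (letters w))) \<subseteq> {..<n}"
    using finite_nat_iff_bounded by blast
  obtain a where odd: "\<And>i. a i \<in> A 1"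
    and nz: "\<And>xs. distinct xs \<Longrightarrow> set xs \<subseteq> {..<n} \<Longrightarrow> prod_list (map a xs) \<noteq> 0"
    using nonvanishing_family[of n] by blast
  \<comment> \<open>Even variables become 1, so only the odd block survives; rescaling by
    \<open>t\<close> then separates the multidegrees.\<close>
  define \<psi> where "\<psi> = (\<lambda>(g :: bit, i). if g = 0 then 1 else a i)"
  have \<psi>: "\<psi> (g, i) \<in> A g" for g i
    using odd one_even by (cases g) (auto simp: \<psi>_def)
  define v where "v M = (\<Sum>w \<in> {w \<in> Poly_Mapping.keys f. mset (letters w) = M}.
       scale (Poly_Mapping.lookup f w) (prod_list (map \<psi> (letters w))))" for M
  have "\<forall>M\<in>F. v M = 0"
  proof (rule multidegrees_independent)
    fix t :: "bit \<times> nat \<Rightarrow> 'k"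
    have "evaluate scale (\<lambda>x. scale (t x) (\<psi> x)) f = 0"
      using f \<psi> subspace_scale[OF subspace_homogeneous] by (simp add: graded_identities_def)
    then show "(\<Sum>M\<in>F. scale (prod_mset (image_mset t M)) (v M)) = 0"
      unfolding evaluate_multihomogeneous
      by (simp add: F_def v_def scale_sum_right prod_list_scale mult.commute)
  qed (simp_all add: F_def multidegree_separation)
  show "\<forall>M. signed_sum f M = 0"
  proof
    fix M
    show "signed_sum f M = 0"
    proof (cases "M \<in> F")
      case False
      then have "{w \<in> Poly_Mapping.keys f. mset (letters w) = M} = {}"
        by (auto simp: F_def)
      then show ?thesis
        unfolding signed_sum_def by (simp only: sum.empty)
    next
      case True
      then obtain w where w: "w \<in> Poly_Mapping.keys f" "mset (letters w) = M"
        by (auto simp: F_def)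
      let ?o = "indices 1 (letters w)"
      show ?thesis
      proof (cases "distinct ?o")
        case True
        have "prod_list (map a (sort ?o)) \<noteq> 0"
          using w n True by (intro nz) auto
        moreover have "v M = scale (signed_sum f M) (prod_list (map a (sort ?o)))"
          using evaluate_multihomogeneous_part[OF \<psi> w(2), of f]
          by (simp add: v_def \<psi>_def map_replicate_const)
        ultimately show ?thesis
          using \<open>\<forall>M\<in>F. v M = 0\<close> \<open>M \<in> F\<close> by simp
      next
        case False
        \<comment> \<open>A repeated odd letter is a property of the multidegree, so every summand
          of the signed sum has sign 0.\<close>
        have "inversion_sign (indices 1 (letters u)) = (0 :: 'k)" if "mset (letters u) = M" for u
        proof (rule inversion_sign_not_distinct)
          show "\<not> distinct (indices 1 (letters u))"
            using False that w(2) mset_eq_indices[of "letters u" "letters w"]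
            by (metis mset_eq_imp_distinct_iff)
        qed
        then show ?thesis
          by (simp add: signed_sum_def)
      qed
    qed
  qed
qed

end


section \<open>The Grassmann algebra\<close>

text \<open>The sum of the coordinates of the image of \<open>p\<close> in the exterior algebra with
  respect to the sorted monomials. It serves to detect elements outside
  \<open>grassmann_ideal\<close>.\<close>

definition inversion_functional :: "('x::linorder, 'k::field) free_algebra \<Rightarrow> 'k" where
  "inversion_functional p =
     (\<Sum>w\<in>Poly_Mapping.keys p. Poly_Mapping.lookup p w * inversion_sign (letters w))"

lemma inversion_functional_superset:
  assumes "finite S" "Poly_Mapping.keys p \<subseteq> S"
  shows "inversion_functional p = (\<Sum>w\<in>S. Poly_Mapping.lookup p w * inversion_sign (letters w))"
  unfolding inversion_functional_def using assms
  by (intro sum.mono_neutral_left) (auto simp: in_keys_iff)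

lemma inversion_functional_zero: "inversion_functional 0 = 0"
  by (simp add: inversion_functional_def)

lemma inversion_functional_add:
  "inversion_functional (p + q) = inversion_functional p + inversion_functional q"
proof -
  let ?S = "Poly_Mapping.keys p \<union> Poly_Mapping.keys q"
  have "Poly_Mapping.keys (p + q) \<subseteq> ?S"
    by (rule Poly_Mapping.keys_add)
  then show ?thesis
    by (simp add: inversion_functional_superset[of ?S] lookup_add distrib_right sum.distrib)
qed

lemma inversion_functional_single:
  "inversion_functional (Poly_Mapping.single w c) = c * inversion_sign (letters w)"
  by (simp add: inversion_functional_def)

lemma free_algebra_induct [case_names zero single add]:
  fixes p :: "('x, 'k::field) free_algebra"
  assumes "P 0" "\<And>w c. P (Poly_Mapping.single w c)" "\<And>p q. P p \<Longrightarrow> P q \<Longrightarrow> P (p + q)"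
  shows "P p"
proof (induction p rule: update_induct)
  case const
  then show ?case by (rule assms(1))
next
  case (update f w c)
  have "Poly_Mapping.update w c f = f + Poly_Mapping.single w c"
    using update.hyps
    by (intro poly_mapping_eqI)
      (auto simp: lookup_update lookup_add lookup_single in_keys_iff when_def)
  with update assms show ?case
    by simp
qed

text \<open>By additivity \<open>a\<close> and \<open>b\<close> may be taken to be multiples of
  words; the two resulting words then differ by a swap of neighbours.\<close>

lemma inversion_functional_anticommutator:
  fixes a b :: "('x::linorder, 'k::field) free_algebra"
  shows "inversion_functional (a * (var i * var j + var j * var i) * b) = 0"
proof (induction a rule: free_algebra_induct)
  case (single u c)
  show ?case
  proof (induction b rule: free_algebra_induct)
    case (single v d)
    show ?case
      using inversion_sign_swap[of "letters u" i j "letters v", where 'k = 'k]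
      by (simp add: distrib_left distrib_right mult_single inversion_functional_add
          inversion_functional_single plus_free_monoid_def)
  qed (simp_all add: distrib_left inversion_functional_add inversion_functional_zero)
qed (simp_all add: distrib_right inversion_functional_add inversion_functional_zero)

lemma inversion_functional_grassmann_ideal:
  assumes "p \<in> grassmann_ideal"
  shows "inversion_functional p = 0"
proof -
  \<comment> \<open>The kernel of the functional is not an ideal; this is the largest two-sided
    ideal inside it.\<close>
  let ?I = "{p :: (nat, 'a) free_algebra. \<forall>a b. inversion_functional (a * p * b) = 0}"
  have "inversion_functional (a * (c * x) * b) = 0" "inversion_functional (a * (x * c) * b) = 0"
    if "x \<in> ?I" for a b c x
  proof -
    have "a * (c * x) * b = (a * c) * x * b" "a * (x * c) * b = a * x * (c * b)"
      by (simp_all add: mult.assoc)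
    with that show "inversion_functional (a * (c * x) * b) = 0"
      "inversion_functional (a * (x * c) * b) = 0"
      by auto
  qed
  then have "two_sided_ideal ?I"
    by (auto simp: two_sided_ideal_def distrib_left distrib_right inversion_functional_add)
      (simp add: inversion_functional_def)
  moreover have "{var i * var j + var j * var i | i j. True} \<subseteq> ?I"
    using inversion_functional_anticommutator by blast
  ultimately have "grassmann_ideal \<subseteq> ?I"
    unfolding grassmann_ideal_def by (intro hull_minimal)
  with assms have "inversion_functional (1 * p * 1) = 0"
    by blast
  then show ?thesis
    by simp
qed

section \<open>Words in the generators of the quotient\<close>

lift_definition grassmann_class :: "(nat, 'k::field) free_algebra \<Rightarrow> 'k grassmann" is "\<lambda>p :: (nat, 'k) free_algebra. p" .

lemma grassmann_class_eq_0_iff: "grassmann_class p = 0 \<longleftrightarrow> p \<in> grassmann_ideal"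
  by transfer (simp add: grassmann_cong_def)

lemma grassmann_class_one: "grassmann_class 1 = 1"
  by transfer (simp add: grassmann_cong_def grassmann_ideal_0)

lemma grassmann_class_var_mult: "grassmann_class (var i * p) = grassmann_gen i * grassmann_class p"
  by transfer (simp add: grassmann_cong_def grassmann_ideal_0)

lemma prod_list_grassmann_gen:
  "prod_list (map grassmann_gen is) = grassmann_class (Poly_Mapping.single (Monomial is) 1)"
proof (induction "is")
  case Nil
  show ?case
    by (simp add: grassmann_class_one flip: zero_free_monoid_def)
next
  case (Cons i "is")
  have "(Poly_Mapping.single (Monomial (i # is)) 1 :: (nat, 'a) free_algebra) =
      var i * Poly_Mapping.single (Monomial is) 1"
    by (simp add: mult_single plus_free_monoid_def)
  with Cons show ?case
    by (simp add: grassmann_class_var_mult)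
qed

text \<open>The functional vanishes on the ideal but takes the value 1 or -1 on a word with distinct
  letters.\<close>

lemma prod_list_grassmann_gen_nonzero:
  assumes "distinct is"
  shows "prod_list (map grassmann_gen is) \<noteq> (0 :: 'k::field grassmann)"
proof
  assume "prod_list (map grassmann_gen is) = (0 :: 'k grassmann)"
  then have "(Poly_Mapping.single (Monomial is) 1 :: (nat, 'k) free_algebra) \<in> grassmann_ideal"
    by (simp add: prod_list_grassmann_gen grassmann_class_eq_0_iff)
  from inversion_functional_grassmann_ideal[OF this] have "inversion_sign is = (0 :: 'k)"
    by (simp add: inversion_functional_single)
  with inversion_sign_distinct[OF assms] show False
    by blast
qed

section \<open>The sign rule in the Grassmann algebra\<close>

lemma grassmann_gen_anticommute:
  "grassmann_gen i * grassmann_gen j = - (grassmann_gen j * grassmann_gen i)"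
proof transfer
  fix i j
  have "var i * var j + var j * var i \<in> (grassmann_ideal :: (nat, 'a) free_algebra set)"
    unfolding grassmann_ideal_def by (rule hull_inc) blast
  then show "grassmann_cong (var i * var j :: (nat, 'a) free_algebra) (- (var j * var i))"
    by (simp only: grassmann_cong_def diff_minus_eq_add)
qed

lemma grassmann_gen_prod_list:
  "grassmann_gen i * prod_list (map grassmann_gen js) =
     (- 1) ^ length js * (prod_list (map grassmann_gen js) * grassmann_gen i)"
proof (induction js)
  case (Cons j js)
  have "grassmann_gen i * (grassmann_gen j * x) = - (grassmann_gen j * (grassmann_gen i * x))"
    for x :: "'a grassmann"
    using arg_cong[OF grassmann_gen_anticommute[of i j], of "\<lambda>y. y * x"] by (simp add: mult.assoc)
  with Cons show ?case
    by (cases "even (length js)") (simp_all add: mult.assoc)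
qed simp

lemma grassmann_prod_list_commute:
  "prod_list (map grassmann_gen is) * prod_list (map grassmann_gen js) =
     (- 1) ^ (length is * length js) * (prod_list (map grassmann_gen js) * prod_list (map grassmann_gen is))"
proof (induction "is")
  case (Cons i "is")
  define P :: "'a grassmann" where "P = prod_list (map grassmann_gen is)"
  define Q :: "'a grassmann" where "Q = prod_list (map grassmann_gen js)"
  have "grassmann_gen i * P * Q = (- 1) ^ (length is * length js) * (grassmann_gen i * Q * P)"
    using Cons by (cases "even (length is * length js)") (simp_all add: P_def Q_def mult.assoc)
  also have "grassmann_gen i * Q = (- 1) ^ length js * (Q * grassmann_gen i)"
    unfolding Q_def by (rule grassmann_gen_prod_list)
  finally show ?case
    by (cases "even (length js)") (simp_all add: P_def Q_def power_add mult.assoc)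
qed simp

lemma of_nat_bit_eq_0_iff: "(of_nat n :: bit) = 0 \<longleftrightarrow> even n"
  by (induction n) (auto simp: add_bit_eq_xor)

text \<open>Both sides are bilinear, so words suffice; there the exponent
  \<open>length is * length js\<close> is odd exactly when both degrees are 1.\<close>

lemma grassmann_component_commute:
  assumes "a \<in> grassmann_component g" "b \<in> grassmann_component h"
  shows "a * b = (if g = 1 \<and> h = 1 then - (b * a) else b * a)"
proof -
  define \<epsilon> :: "'a grassmann" where "\<epsilon> = (if g = 1 \<and> h = 1 then - 1 else 1)"
  have \<epsilon>: "\<epsilon> * x = x * \<epsilon>" for x
    by (simp add: \<epsilon>_def)
  have words: "prod_list (map grassmann_gen is) * prod_list (map grassmann_gen js) =
      \<epsilon> * (prod_list (map grassmann_gen js) * prod_list (map grassmann_gen is))"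
    if "of_nat (length is) = g" "of_nat (length js) = h" for "is" js
  proof -
    have "g = 1 \<longleftrightarrow> odd (length is)" "h = 1 \<longleftrightarrow> odd (length js)"
      using that of_nat_bit_eq_0_iff by (metis bit_not_zero_iff zero_neq_one)+
    then have "\<epsilon> = (- 1) ^ (length is * length js)"
      by (auto simp: \<epsilon>_def)
    then show ?thesis
      using grassmann_prod_list_commute by metis
  qed
  have "x * b = \<epsilon> * (b * x)"
    if x: "x \<in> {prod_list (map grassmann_gen is) | is. of_nat (length is) = g}" for x
    using assms(2) unfolding grassmann_component_def
  proof (induction rule: grassmann.span_induct_alt)
    case (step c y z)
    then have "x * y = \<epsilon> * (y * x)"
      using x words by auto
    with step show ?case
      by (simp add: distrib_left distrib_right grassmann.scale_mult_left grassmann.scale_mult_right)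
  qed simp
  with assms(1) have "a * b = \<epsilon> * (b * a)"
    unfolding grassmann_component_def
    by (induction rule: grassmann.span_induct_alt)
      (simp_all add: distrib_left distrib_right grassmann.scale_mult_left grassmann.scale_mult_right)
  then show ?thesis
    by (simp add: \<epsilon>_def)
qed

lemma prod_list_grassmann_gen_component:
  "of_nat (length is) = g \<Longrightarrow> prod_list (map grassmann_gen is) \<in> grassmann_component g"
  unfolding grassmann_component_def by (intro grassmann.span_base) blast

interpretation grassmann: regular_supercommutative_algebra
  "grassmann_scale :: 'k::field_char_0 \<Rightarrow> _" grassmann_component
proof
  fix g :: bit and a b :: "'k grassmann" and n :: nat
  show "grassmann.subspace (grassmann_component g :: 'k grassmann set)"
    by (simp add: grassmann_component_def)
  show "(1 :: 'k grassmann) \<in> grassmann_component 0"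
    using prod_list_grassmann_gen_component[of "[]" 0] by simp
  show "a \<in> grassmann_component 0 \<Longrightarrow> b \<in> grassmann_component g \<Longrightarrow> a * b = b * a"
    using grassmann_component_commute[of a 0 b g] by simp
  show "a \<in> grassmann_component 1 \<Longrightarrow> b \<in> grassmann_component 1 \<Longrightarrow> a * b = - (b * a)"
    using grassmann_component_commute[of a 1 b 1] by simp
  have "grassmann_gen i \<in> (grassmann_component 1 :: 'k grassmann set)" for i
    using prod_list_grassmann_gen_component[of "[i]" 1] by simp
  then show "\<exists>as. length as = n \<and> set as \<subseteq> grassmann_component 1 \<and> prod_list as \<noteq> (0 :: 'k grassmann)"
    using prod_list_grassmann_gen_nonzero[of "[0..<n]"]
    by (intro exI[of _ "map grassmann_gen [0..<n]"]) auto
qed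


section \<open>Regular gradings\<close>

lemma (in Z2_graded_algebra) homogeneous_sum_eq_0:
  assumes "x \<in> A 0" "y \<in> A 1" "x + y = 0"
  shows "y = 0"
proof -
  have "0 \<in> A 0" "0 \<in> A 1"
    using subspace_0 subspace_component by blast+
  then have "(x, y) = (0, 0)"
    using assms direct_sum[of 0] by (metis add_0 fst_conv mem_Sigma_iff snd_conv)
  then show ?thesis
    by simp
qed

text \<open>The odd part \<open>e1\<close> of \<open>1\<close> satisfies \<open>a * e1 = 0\<close> for every homogeneous \<open>a\<close>, hence \<open>e1 = 1 * e1 = 0\<close>.\<close>

lemma (in Z2_graded_algebra) one_in_component: "1 \<in> A 0"
proof -
  obtain e0 e1 where e: "e0 \<in> A 0" "e1 \<in> A 1" "1 = e0 + e1"
    using direct_sum[of 1] by (metis ex1_implies_ex mem_Times_iff)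
  have split: "a = a * e0 + a * e1" for a
    using e(3) by (metis distrib_left mult.right_neutral)
  have "a * e1 = 0" if "a \<in> A 0" for a
  proof (rule homogeneous_sum_eq_0)
    show "a * e0 - a \<in> A 0" "a * e1 \<in> A 1"
      using mult_component[OF that e(1)] mult_component[OF that e(2)] that
        subspace_diff[OF subspace_component] by auto
  qed (use split[of a] in \<open>simp add: algebra_simps\<close>)
  \<comment> \<open>For \<open>a = e1\<close> the degrees are exchanged: the odd part of
    \<open>0 = e1 * e1 + (e1 * e0 - e1)\<close> gives \<open>e1 * e0 = e1\<close>, hence the
    claim.\<close>
  moreover have "e1 * e1 = 0"
  proof -
    have "e1 * e1 \<in> A 0" "e1 * e0 - e1 \<in> A 1"
      using mult_component[OF e(2) e(2)] mult_component[OF e(2) e(1)] e(2)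
        subspace_diff[OF subspace_component] by auto
    moreover have "e1 * e1 + (e1 * e0 - e1) = 0"
      using split[of e1] by (simp add: algebra_simps)
    ultimately have "e1 * e0 - e1 = 0"
      by (rule homogeneous_sum_eq_0)
    then show ?thesis
      using split[of e1] by simp
  qed
  ultimately have "e1 = 0"
    using e by (metis add_0 distrib_right mult_1)
  with e show ?thesis
    by simp
qed

text \<open>Multiplicativity gives 1 whenever an argument is 0, and \<open>\<beta> 1 1\<close>
  squares to 1 because \<open>1 + 1 = 0\<close> in the group. If it were 1, the arguments 0 and 1
  would be indistinguishable, against minimality.\<close>

lemma minimal_bicharacter_values:
  assumes "skew_symmetric_bicharacter \<beta>" "minimal_decomposition \<beta>"
  shows "\<beta> 0 0 = 1 \<and> \<beta> 0 1 = 1 \<and> \<beta> 1 0 = 1 \<and> \<beta> 1 1 = - 1"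
proof -
  have nz: "\<beta> g h \<noteq> 0" and left: "\<beta> (g + h) k = \<beta> g k * \<beta> h k"
    and right: "\<beta> g (h + k) = \<beta> g h * \<beta> g k" for g h k
    using assms(1) unfolding skew_symmetric_bicharacter_def by blast+
  have \<beta>0: "\<beta> 0 h = 1" "\<beta> h 0 = 1" for h
    using left[of 0 0 h] right[of h 0 0] nz by simp_all
  have "\<beta> 1 1 * \<beta> 1 1 = 1"
    using left[of 1 1 1] \<beta>0 by simp
  moreover have "\<beta> 1 1 \<noteq> 1"
  proof
    assume "\<beta> 1 1 = 1"
    then have "\<beta> g 0 = \<beta> g 1" for g
      by (cases g) (simp_all add: \<beta>0)
    with assms(2) show False
      unfolding minimal_decomposition_def by (metis zero_neq_one)
  qed
  ultimately show ?thesis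
    using \<beta>0 by (metis square_eq_1_iff)
qed

theorem lemma9:
  fixes scale :: "'k::{alg_closed_field, field_char_0} \<Rightarrow> 'a::ring_1 \<Rightarrow> 'a"
    and A :: "bit \<Rightarrow> 'a set"
    and \<beta> :: "bit \<Rightarrow> bit \<Rightarrow> 'k"
  assumes "Z2_graded_algebra scale A"
    and "skew_symmetric_bicharacter \<beta>"
    and "regular_grading scale A \<beta>"
    and "minimal_decomposition \<beta>"
  shows "(\<beta> 0 0 = 1 \<and> \<beta> 0 1 = 1 \<and> \<beta> 1 0 = 1 \<and> \<beta> 1 1 = - 1) \<and>
    \<not> (\<exists>B. finite_dimensional_vector_space scale B) \<and>
    graded_identities scale A =
      graded_identities grassmann_scale (grassmann_component :: bit \<Rightarrow> 'k grassmann set)"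
proof -
  interpret Z2_graded_algebra scale A
    by (rule assms(1))
  have \<beta>: "\<beta> 0 0 = 1 \<and> \<beta> 0 1 = 1 \<and> \<beta> 1 0 = 1 \<and> \<beta> 1 1 = - 1"
    using minimal_bicharacter_values assms(2,4) .
  have comm: "a * b = scale (\<beta> g h) (b * a)" if "a \<in> A g" "b \<in> A h" for a b g h
    using assms(3) that unfolding regular_grading_def by blast
  interpret regular_supercommutative_algebra scale A
  proof
    fix g :: bit and a b :: 'a and n :: nat
    show "subspace (A g)" "1 \<in> A 0"
      by (rule subspace_component one_in_component)+
    show "a * b = b * a" if "a \<in> A 0" "b \<in> A g"
      using comm[OF that] \<beta> by (cases g) simp_all
    show "a * b = - (b * a)" if "a \<in> A 1" "b \<in> A 1"
      using comm[OF that] \<beta> by simp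
    \<comment> \<open>Regularity for the constant degree sequence 1, ..., 1 of length
      \<open>n\<close>.\<close>
    obtain as where "list_all2 (\<lambda>g a. a \<in> A g) (replicate n 1) as" "prod_list as \<noteq> 0"
      using assms(3) unfolding regular_grading_def by blast
    then show "\<exists>as. length as = n \<and> set as \<subseteq> A 1 \<and> prod_list as \<noteq> 0"
      by (intro exI[of _ as]) (auto simp: list_all2_conv_all_nth in_set_conv_nth)
  qed
  show ?thesis
    \<comment> \<open>Both sets of identities consist of the polynomials all of whose signed sums
      vanish.\<close>
    using \<beta> infinite_dimensional
    by (auto simp: graded_identities_iff grassmann.graded_identities_iff)
qed

end
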